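(* Let $\mathcal M_k$ be an MDP in a lifelong Markov decision process (L-MDP), with set of available actions $\mathcal A$, and let $\epsilon_k$ denote the maximum distance in the underlying structure of the closest pair of available actions, i.e., $$\epsilon_k := \sup_{a_i\in\mathcal A}\ \inf_{a_j\in\mathcal A}\ \lVert e_i-e_j\rVert_1 ,$$ where $e_i,e_j\in\mathcal E$ are the underlying structures of $a_i,a_j$ (that is, $a_i=\phi(e_i)$, $a_j=\phi(e_j)$). Let $\delta_k\ge 0$. If there exist $\varphi:\mathcal S\times\mathcal S\times\hat{\mathcal E}\to[0,1]$ and $\hat\phi_k:\hat{\mathcal E}\times\mathcal A\to[0,1]$ such that $$\sup_{s\in\mathcal S,\,a\in\mathcal A}\ \mathrm{KL}\Big(P(S_{t+1}\mid S_t=s,A_t=a)\ \Big\Vert\ P(S_{t+1}\mid S_t=s,A_t=\hat A)\Big)\ \le\ \frac{\delta_k^2}{2},$$ where $\hat A\sim\hat\phi_k(\cdot\mid\hat E)$ and $\hat E\sim\varphi(\cdot\mid S_t,S_{t+1})$, then $$v^{\mu^*}(s_0)-v^{\pi_k^{**}}(s_0)\ \le\ \frac{\gamma\,(\rho\,\epsilon_k+\delta_k)}{(1-\gamma)^2}\,R_{\max}.$$ Here $s_0$ is the initial state, $\mu^*$ is a hypothetical policy that acts optimally given access to all possible actions, and $\pi_k^{**}$ is the best overall policy in $\mathcal M_k$ that can be represented using the fixed $\hat\phi_k$.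
   Context: **L-MDP.** The set of all possible actions (those available now and those that may become available later) is viewed as a space $\mathcal E\subseteq\mathbb R^d$ of underlying structures. An L-MDP is $\mathscr L=(\mathcal M_0,\mathcal E,\mathcal D,\mathcal F)$, extending a base MDP $\mathcal M_0=(\mathcal S,\mathcal A,\mathcal P,\mathcal R,\gamma,d_0)$ with state set $\mathcal S$ (taken finite for notational ease), empty action set $\mathcal A=\emptyset$, transition function $\mathcal P$, discount $\gamma\in[0,1)$ and initial-state distribution $d_0$. The reward function depends only on the state: $\mathcal R(s)=\mathbf E[R_t\mid S_t=s]$, where $R_t\in[-R_{\max},R_{\max}]$ for some finite $R_{\max}$. At the start of episode $\tau$, new actions are added with probability $\mathcal F(\tau)$; when they are added, the nonempty set added is drawn from a distribution $\mathcal D_\tau$ over subsets of $\mathcal E$, and $\mathcal D=\{\mathcal D_\tau\}$. The index $k$ counts the number of times the action set has changed. If $u_k\subseteq\mathcal E$ is the set added at the $k$-th change, the agent observes the discrete actions $\mathcal A_k=\{\phi(e_i): e_i\in u_k\}$, where $\phi$ is a map relating underlying structures to observed discrete actions. The MDP $\mathcal M_k$ is the same as $\mathcal M_{k-1}$ except that its action set $\mathcal A$ is the union of the action set of $\mathcal M_{k-1}$ and $\mathcal A_k$. **Transitions.** $S_t,A_t$ are the state and action at time $t$. $\mathcal P(s,a,s')$ denotes the transition probability $P(s'\mid s,e)$ from $s$ to $s'$, where $a=\phi(e)$. **$\rho$-Lipschitz condition.** The transition probabilities are assumed $\rho$-Lipschitz in the structure of actions: there is $\rho>0$ such that for all $s,s'\in\mathcal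 S$ and $e_i,e_j\in\mathcal E$, $$\lVert P(s'\mid s,e_i)-P(s'\mid s,e_j)\rVert_1\le\rho\,\lVert e_i-e_j\rVert_1 .$$ **Values.** The state value function of a policy $\pi$ is $v^{\pi}(s)=\mathbf E\big[\sum_{t=0}^\infty\gamma^tR_t\mid s,\pi\big]$, the expected discounted sum of rewards starting from state $s$ and following $\pi$; optimal (best) policies maximize it. **Two-component policies.** $\hat{\mathcal E}\subseteq\mathbb R^d$ is the inferred structure in the action space. An overall policy consists of a state-conditional component $\beta:\mathcal S\times\hat{\mathcal E}\to[0,1]$, a distribution over $\hat{\mathcal E}$ given the state, and $\hat\phi_k$, a distribution over $\mathcal A$ given an element of $\hat{\mathcal E}$ (an estimator of $\phi$): in state $S_t$ one samples $E_t\sim\beta(S_t,\cdot)$ and then obtains the action $A_t$ from $\hat\phi_k(\cdot\mid E_t)$. The policy $\pi_k^{**}$ is the best such overall policy with $\hat\phi_k$ held fixed. **Inverse dynamics.** $\varphi(\cdot\mid s,s')$ is a distribution over $\hat{\mathcal E}$ given two states $s,s'$, predicting which element caused the transition from $s$ to $s'$. In the KL condition, $\hat A$ is the action obtained by feeding the transition $(S_t,S_{t+1})$ produced by action $a$ from state $s$ through $\varphi$ and then $\hat\phi_k$. KL is the Kullback–Leibler divergence.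
   Formalization: In the definition of ε_k the supremum is taken over the underlying structures of all possible actions and the infimum over those of available actions; as printed (both over available actions) ε_k is always 0 and the bound fails when a better action is not yet available. *)

theory Defs
  imports "HOL-Probability.Probability"
begin

section \<open>Markov decision processes and policies\<close>

text \<open>
  The state set is a finite type. The transition function is total on the action type; only
  \<open>actions\<close> are available to a policy. \<open>reward M s\<close> is the law of $R_t$ given $S_t = s$, so the
  reward function $\mathcal{R}(s)$ is its mean, and \<open>rmax\<close> is the bound $R_{\max}$.
\<close>

record ('s, 'a) mdp =
  actions :: "'a set"
  transition :: "'s \<Rightarrow> 'a \<Rightarrow> 's pmf"
  reward :: "'s \<Rightarrow> real measure"
  rmax :: real
  discount :: real
  init :: "'s pmf"

definition is_mdp :: "('s, 'a) mdp \<Rightarrow> bool" where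
  "is_mdp M \<longleftrightarrow>
     0 \<le> discount M \<and> discount M < 1 \<and>
     (\<forall>s. reward M s \<in> space (prob_algebra borel) \<and> (AE r in reward M s. \<bar>r\<bar> \<le> rmax M))"

text \<open>
  Actions are discrete, so the action space carries the full power set as its \<open>\<sigma>\<close>-algebra.
\<close>

definition policies :: "('s, 'a) mdp \<Rightarrow> ('s \<Rightarrow> 'a measure) set" where
  "policies M = {\<pi>. \<forall>s. \<pi> s \<in> space (prob_algebra (count_space (actions M)))}"

text \<open>
  A trajectory is a sequence of triples $(S_t, A_t, R_t)$. Its law is the Ionescu-Tulcea measure
  of the kernels that draw the triple at time 0 from the start state, and the triple at time
  $t+1$ from the transition law of $(S_t, A_t)$.
\<close>

definition step_space :: "('s, 'a) mdp \<Rightarrow> ('s \<times> 'a \<times> real) measure" where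
  "step_space M = count_space UNIV \<Otimes>\<^sub>M (count_space (actions M) \<Otimes>\<^sub>M borel)"

definition step_law ::
  "('s, 'a) mdp \<Rightarrow> ('s \<Rightarrow> 'a measure) \<Rightarrow> 's \<Rightarrow> ('s \<times> 'a \<times> real) measure" where
  "step_law M \<pi> s = return (count_space UNIV) s \<Otimes>\<^sub>M (\<pi> s \<Otimes>\<^sub>M reward M s)"

primrec step_kernel ::
  "('s, 'a) mdp \<Rightarrow> ('s \<Rightarrow> 'a measure) \<Rightarrow> 's \<Rightarrow> nat \<Rightarrow> (nat \<Rightarrow> 's \<times> 'a \<times> real)
     \<Rightarrow> ('s \<times> 'a \<times> real) measure" where
  "step_kernel M \<pi> s 0 \<omega> = step_law M \<pi> s"
| "step_kernel M \<pi> s (Suc t) \<omega> =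
     (case \<omega> t of (s', a, r) \<Rightarrow> measure_pmf (transition M s' a) \<bind> step_law M \<pi>)"

definition trajectory ::
  "('s, 'a) mdp \<Rightarrow> ('s \<Rightarrow> 'a measure) \<Rightarrow> 's \<Rightarrow> (nat \<Rightarrow> 's \<times> 'a \<times> real) measure" where
  "trajectory M \<pi> s =
     projective_family.lim UNIV
       (Ionescu_Tulcea.CI (step_kernel M \<pi> s) (\<lambda>_. step_space M)) (\<lambda>_. step_space M)"

definition state_value :: "('s, 'a) mdp \<Rightarrow> ('s \<Rightarrow> 'a measure) \<Rightarrow> 's \<Rightarrow> real" where
  "state_value M \<pi> s =
     (\<integral>\<omega>. (\<Sum>t. discount M ^ t * snd (snd (\<omega> t))) \<partial>trajectory M \<pi> s)"

definition best_policy ::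
  "('s, 'a) mdp \<Rightarrow> ('s \<Rightarrow> 'a measure) set \<Rightarrow> ('s \<Rightarrow> 'a measure) \<Rightarrow> bool" where
  "best_policy M P \<pi> \<longleftrightarrow>
     \<pi> \<in> P \<and> (\<forall>\<pi>'\<in>P. \<forall>s. state_value M \<pi>' s \<le> state_value M \<pi> s)"


section \<open>Lifelong Markov decision processes\<close>

text \<open>
  \<open>structures\<close> is $\mathcal{E}$, \<open>change_law\<close> is $\mathcal{D}$, \<open>change_prob\<close> is $\mathcal{F}$, and
  \<open>obs\<close> is $\phi$.
\<close>

record ('s, 'a, 'd) lmdp =
  base :: "('s, 'a) mdp"
  structures :: "(real ^ 'd::finite) set"
  change_law :: "nat \<Rightarrow> (real ^ 'd) set measure"
  change_prob :: "nat \<Rightarrow> real"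
  obs :: "real ^ 'd \<Rightarrow> 'a"

definition is_lmdp :: "('s, 'a, 'd::finite) lmdp \<Rightarrow> bool" where
  "is_lmdp L \<longleftrightarrow>
     is_mdp (base L) \<and> actions (base L) = {} \<and>
     (\<forall>\<tau>. 0 \<le> change_prob L \<tau> \<and> change_prob L \<tau> \<le> 1) \<and>
     (\<forall>\<tau>. prob_space (change_law L \<tau>) \<and>
          space (change_law L \<tau>) \<subseteq> {u. u \<subseteq> structures L \<and> u \<noteq> {}})"

text \<open>
  \<open>lmdp_run L \<tau> k M\<close>: after the first \<open>\<tau>\<close> episode starts the action set may have changed exactly
  \<open>k\<close> times, and \<open>M\<close> is the resulting MDP $\mathcal{M}_k$.
\<close>

inductive lmdp_run :: "('s, 'a, 'd::finite) lmdp \<Rightarrow> nat \<Rightarrow> nat \<Rightarrow> ('s, 'a) mdp \<Rightarrow> bool"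
  for L where
  start: "lmdp_run L 0 0 (base L)"
| keep: "lmdp_run L \<tau> k M \<Longrightarrow> change_prob L \<tau> < 1 \<Longrightarrow> lmdp_run L (Suc \<tau>) k M"
| change: "lmdp_run L \<tau> k M \<Longrightarrow> 0 < change_prob L \<tau> \<Longrightarrow> u \<in> space (change_law L \<tau>) \<Longrightarrow>
     lmdp_run L (Suc \<tau>) (Suc k) (M\<lparr>actions := actions M \<union> obs L ` u\<rparr>)"

text \<open>The hypothetical MDP in which every possible action is already available.\<close>

definition full_mdp :: "('s, 'a, 'd::finite) lmdp \<Rightarrow> ('s, 'a) mdp" where
  "full_mdp L = (base L)\<lparr>actions := obs L ` structures L\<rparr>"

definition l1_norm :: "real ^ 'd::finite \<Rightarrow> real" where
  "l1_norm x = (\<Sum>i\<in>UNIV. \<bar>x $ i\<bar>)"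

text \<open>$P(\cdot \mid s, e)$\<close>

definition struct_transition :: "('s, 'a, 'd::finite) lmdp \<Rightarrow> 's \<Rightarrow> real ^ 'd \<Rightarrow> 's pmf" where
  "struct_transition L s e = transition (base L) s (obs L e)"

text \<open>The norm on the left-hand side is the $1$-norm of a vector indexed by the next state.\<close>

definition lipschitz_structure :: "('s::finite, 'a, 'd::finite) lmdp \<Rightarrow> real \<Rightarrow> bool" where
  "lipschitz_structure L \<rho> \<longleftrightarrow>
     0 < \<rho> \<and>
     (\<forall>s. \<forall>e\<^sub>i\<in>structures L. \<forall>e\<^sub>j\<in>structures L.
        (\<Sum>s'\<in>UNIV. \<bar>pmf (struct_transition L s e\<^sub>i) s' - pmf (struct_transition L s e\<^sub>j) s'\<bar>)
          \<le> \<rho> * l1_norm (e\<^sub>i - e\<^sub>j))"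

text \<open>
  The supremum ranges over the structures of all possible actions, the infimum over the
  structures of the actions available in \<open>M\<close>. (If the supremum ranged over the actions of \<open>M\<close>
  too, each would be at distance 0 from itself and the gap would always be 0.) The value is
  \<open>\<infinity>\<close> if the distances are unbounded.
\<close>

definition structure_gap :: "('s, 'a, 'd::finite) lmdp \<Rightarrow> ('s, 'a) mdp \<Rightarrow> ereal" where
  "structure_gap L M =
     (SUP e\<^sub>i\<in>structures L. INF e\<^sub>j\<in>{e \<in> structures L. obs L e \<in> actions M}.
        ereal (l1_norm (e\<^sub>i - e\<^sub>j)))"


section \<open>Two-component policies and inverse dynamics\<close>

text \<open>
  The inferred structure is a measurable space \<open>E\<close> whose carrier is a subset of
  $\mathbb{R}^d$. Its \<open>\<sigma>\<close>-algebra is left open: the power set gives probability mass functions,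
  the Borel sets give policies with densities. \<open>h\<close> is the kernel $\hat\phi_k$.
\<close>

definition overall_policies ::
  "(real ^ 'd::finite) measure \<Rightarrow> (real ^ 'd \<Rightarrow> 'a measure) \<Rightarrow> ('s \<Rightarrow> 'a measure) set" where
  "overall_policies E h =
     {\<pi>. \<exists>\<beta>. (\<forall>s. \<beta> s \<in> space (prob_algebra E)) \<and> (\<forall>s. \<pi> s = \<beta> s \<bind> h)}"

text \<open>
  The law of $\hat A$: the transition produced by \<open>a\<close> in \<open>s\<close> is fed through the inverse
  dynamics \<open>\<psi>\<close> (the $\varphi$ of the usual notation) and then through \<open>h\<close>.
\<close>

definition inferred_action ::
  "('s, 'a) mdp \<Rightarrow> ('s \<Rightarrow> 's \<Rightarrow> (real ^ 'd::finite) measure) \<Rightarrow> (real ^ 'd \<Rightarrow> 'a measure)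
     \<Rightarrow> 's \<Rightarrow> 'a \<Rightarrow> 'a measure" where
  "inferred_action M \<psi> h s a =
     measure_pmf (transition M s a) \<bind> (\<lambda>s'. \<psi> s s' \<bind> h)"

definition inferred_transition ::
  "('s, 'a) mdp \<Rightarrow> ('s \<Rightarrow> 's \<Rightarrow> (real ^ 'd::finite) measure) \<Rightarrow> (real ^ 'd \<Rightarrow> 'a measure)
     \<Rightarrow> 's \<Rightarrow> 'a \<Rightarrow> 's measure" where
  "inferred_transition M \<psi> h s a =
     inferred_action M \<psi> h s a \<bind> (\<lambda>a'. measure_pmf (transition M s a'))"

text \<open>
  $\mathrm{KL}(P \,\Vert\, Q)$ in nats. The library takes the reference measure first and is
  meaningful only under absolute continuity.
\<close>

definition kl :: "'x measure \<Rightarrow> 'x measure \<Rightarrow> ereal" where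
  "kl P Q = (if absolutely_continuous Q P then ereal (KL_divergence (exp 1) Q P) else \<infinity>)"

end

theory Submission
  imports Defs
begin

text \<open>
  The marginals of the Ionescu-Tulcea measure show that the value of a policy is the Neumann series
  of the induced state transition matrix applied to the mean rewards, hence satisfies the Bellman
  equation and is bounded by \<open>R / (1 - \<gamma>)\<close>. In each state choose a possible action whose expected
  next value is at least that of \<open>\<mu>\<close>, then an available action whose structure is closer than any
  given \<open>\<eta> > \<epsilon>\<^sub>k\<close>, and feed that action through the inverse dynamics and \<open>h\<^sub>k\<close>. This defines an
  overall policy whose next-state law differs from that of the chosen possible action by at most
  \<open>\<rho> * \<eta> + \<delta>\<^sub>k\<close> in the 1-norm, by the Lipschitz condition and Pinsker's inequality. So its expected
  next value of \<open>\<mu>\<close> is at most \<open>(\<rho> * \<eta> + \<delta>\<^sub>k) * R / (1 - \<gamma>)\<close> smaller, and a maximum over the states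
  in the Bellman equations gives the bound with \<open>\<eta>\<close>, which is then sent to \<open>\<epsilon>\<^sub>k\<close>. If \<open>\<epsilon>\<^sub>k\<close> is
  infinite, only \<open>\<gamma> * R = 0\<close> needs an argument, and then both values agree.
\<close>

section \<open>Pinsker's inequality\<close>

text \<open>The difference of the sides vanishes at 1 and has derivative
  \<open>ln x + 1 / x - 1\<close>, which is nonnegative by \<open>ln y \<le> y - 1\<close> at
  \<open>y = 1 / x\<close>.\<close>

lemma ln_lower_bound_mult:
  fixes u :: real
  assumes "1 \<le> u"
  shows "2 * (u - 1) \<le> (u + 1) * ln u"
proof -
  have "(\<lambda>u. (u + 1) * ln u - 2 * (u - 1)) 1 \<le> (\<lambda>u. (u + 1) * ln u - 2 * (u - 1)) u"
  proof (rule DERIV_nonneg_imp_nondecreasing[OF assms])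
    fix x :: real assume x: "1 \<le> x"
    have "((\<lambda>u. (u + 1) * ln u - 2 * (u - 1)) has_real_derivative (ln x + (x + 1) / x - 2)) (at x)"
      using x by (auto intro!: derivative_eq_intros simp: field_simps)
    moreover have "0 \<le> ln x + (x + 1) / x - 2"
      using ln_le_minus_one[of "1 / x"] x by (simp add: ln_div field_simps)
    ultimately show "\<exists>y. ((\<lambda>u. (u + 1) * ln u - 2 * (u - 1)) has_real_derivative y) (at x) \<and> 0 \<le> y"
      by blast
  qed
  then show ?thesis by simp
qed

text \<open>Replace \<open>u\<close> by \<open>1 / u\<close> in the bound for arguments above 1 and
  multiply by \<open>u\<close>.\<close>

lemma ln_upper_bound_mult:
  fixes u :: real
  assumes "0 < u" "u \<le> 1"
  shows "(u + 1) * ln u \<le> 2 * (u - 1)"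
proof -
  have "2 * (1 / u - 1) \<le> (1 / u + 1) * ln (1 / u)"
    using assms by (intro ln_lower_bound_mult) (simp add: field_simps)
  then have "u * (2 * (1 / u - 1)) \<le> u * ((1 / u + 1) * ln (1 / u))"
    using assms by (intro mult_left_mono) auto
  moreover have "u * (2 * (1 / u - 1)) = 2 * (1 - u)"
    using assms by (simp add: field_simps)
  moreover have "u * ((1 / u + 1) * ln (1 / u)) = (u + 1) * (- ln u)"
    using assms by (simp add: ln_div field_simps)
  ultimately show ?thesis by simp
qed

text \<open>Both sides agree at 1, and the difference has derivative \<open>4 * ((u + 1) * ln u - 2 * (u - 1))\<close>.\<close>

lemma square_le_relative_entropy_term:
  fixes u :: real
  assumes "0 \<le> u"
  shows "3 * (u - 1)\<^sup>2 \<le> (4 + 2 * u) * (u * ln u - u + 1)"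
proof -
  define h where "h u = (4 + 2 * u) * (u * ln u - u + 1) - 3 * (u - 1)\<^sup>2" for u :: real
  have D: "(h has_real_derivative 4 * ((x + 1) * ln x - 2 * (x - 1))) (at x)" if "0 < x" for x
    unfolding h_def using that
    by (auto intro!: derivative_eq_intros simp: field_simps power2_eq_square)
  have "0 \<le> h u" if "0 < u"
  proof (cases "1 \<le> u")
    case True
    have "h 1 \<le> h u"
    proof (rule DERIV_nonneg_imp_nondecreasing[OF True, of h])
      fix x :: real assume "1 \<le> x"
      then show "\<exists>y. (h has_real_derivative y) (at x) \<and> 0 \<le> y"
        using D[of x] ln_lower_bound_mult[of x]
        by (intro exI[of _ "4 * ((x + 1) * ln x - 2 * (x - 1))"]) auto
    qed
    then show ?thesis by (simp add: h_def)
  next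
    case False
    have "h u \<ge> h 1"
    proof (rule DERIV_nonpos_imp_nonincreasing[of u 1 h])
      show "\<exists>y. (h has_real_derivative y) (at x) \<and> y \<le> 0" if "u \<le> x" "x \<le> 1" for x
        using D[of x] ln_upper_bound_mult[of x] that \<open>0 < u\<close>
        by (intro exI[of _ "4 * ((x + 1) * ln x - 2 * (x - 1))"]) auto
    qed (use False in simp)
    then show ?thesis by (simp add: h_def)
  qed
  \<comment> \<open>The derivative is available only for positive arguments; at 0 the value
    \<open>h 0 = 1\<close> is computed directly.\<close>
  then show ?thesis using assms by (cases "u = 0") (auto simp: h_def)
qed

text \<open>The homogeneous form of the one-variable inequality: put \<open>u = p / q\<close> and
  multiply by the square of \<open>q\<close>, giving one factor \<open>q\<close> to each factor on
  the right.\<close>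

lemma square_diff_le_relative_entropy_term:
  fixes p q :: real
  assumes "0 \<le> p" "0 \<le> q" "q = 0 \<Longrightarrow> p = 0"
  shows "3 * (p - q)\<^sup>2 \<le> (4 * q + 2 * p) * (p * ln (p / q) - p + q)"
proof (cases "q = 0")
  case False
  then have q: "0 < q" using assms by simp
  have "q\<^sup>2 * (3 * (p / q - 1)\<^sup>2) \<le> q\<^sup>2 * ((4 + 2 * (p / q)) * (p / q * ln (p / q) - p / q + 1))"
    using assms by (intro mult_left_mono square_le_relative_entropy_term) auto
  also have "q\<^sup>2 * (3 * (p / q - 1)\<^sup>2) = 3 * (q * (p / q - 1))\<^sup>2"
    by (simp add: power_mult_distrib)
  also have "q * (p / q - 1) = p - q" using q by (simp add: field_simps)
  also have "q\<^sup>2 * ((4 + 2 * (p / q)) * (p / q * ln (p / q) - p / q + 1))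
     = (q * (4 + 2 * (p / q))) * (q * (p / q * ln (p / q) - p / q + 1))"
    by (simp add: power2_eq_square)
  also have "q * (4 + 2 * (p / q)) = 4 * q + 2 * p" using q by (simp add: field_simps)
  also have "q * (p / q * ln (p / q) - p / q + 1) = p * ln (p / q) - p + q"
    using q by (simp add: ring_distribs)
  finally show ?thesis .
qed (use assms in simp)

text \<open>Cauchy-Schwarz with weights: the squared differences are at most
  \<open>a x * b x\<close>. The weights \<open>a\<close> sum to \<open>(4 + 2) / 3 = 2\<close>, and
  the \<open>b\<close> sum to the relative entropy because the corrections
  \<open>- p x + q x\<close> cancel in total.\<close>

lemma pinsker_sum:
  fixes p q :: "'b \<Rightarrow> real"
  assumes p: "\<And>x. x \<in> X \<Longrightarrow> 0 \<le> p x" "sum p X = 1"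
    and q: "\<And>x. x \<in> X \<Longrightarrow> 0 \<le> q x" "sum q X = 1"
    and ac: "\<And>x. x \<in> X \<Longrightarrow> q x = 0 \<Longrightarrow> p x = 0"
  shows "(\<Sum>x\<in>X. \<bar>p x - q x\<bar>)\<^sup>2 \<le> 2 * (\<Sum>x\<in>X. p x * ln (p x / q x))"
proof -
  define a where "a x = (4 * q x + 2 * p x) / 3" for x
  define b where "b x = p x * ln (p x / q x) - p x + q x" for x
  have ab: "(p x - q x)\<^sup>2 \<le> a x * b x" and a: "0 \<le> a x" if "x \<in> X" for x
    using square_diff_le_relative_entropy_term[OF p(1) q(1) ac, OF that that that]
      p(1)[OF that] q(1)[OF that]
    by (auto simp: a_def b_def)
  have b: "0 \<le> b x" if "x \<in> X" for x
  proof (cases "a x = 0")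
    case True
    with p(1)[OF that] q(1)[OF that] have "p x = 0" "q x = 0" by (auto simp: a_def)
    then show ?thesis by (simp add: b_def)
  next
    case False
    with a[OF that] have "0 < a x" by simp
    with order_trans[OF zero_le_power2 ab[OF that]] show ?thesis
      by (simp add: zero_le_mult_iff)
  qed
  have "\<bar>p x - q x\<bar> \<le> sqrt (a x) * sqrt (b x)" if "x \<in> X" for x
    using real_sqrt_le_mono[OF ab[OF that]] by (simp add: real_sqrt_mult)
  then have "(\<Sum>x\<in>X. \<bar>p x - q x\<bar>) \<le> (\<Sum>x\<in>X. sqrt (a x) * sqrt (b x))"
    by (rule sum_mono)
  then have "(\<Sum>x\<in>X. \<bar>p x - q x\<bar>)\<^sup>2 \<le> (\<Sum>x\<in>X. sqrt (a x) * sqrt (b x))\<^sup>2"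
    by (intro power_mono sum_nonneg) auto
  also have "\<dots> \<le> (\<Sum>x\<in>X. (sqrt (a x))\<^sup>2) * (\<Sum>x\<in>X. (sqrt (b x))\<^sup>2)"
    by (rule Cauchy_Schwarz_ineq_sum)
  also have "\<dots> = sum a X * sum b X"
    using a b by (intro arg_cong2[where f="(*)"] sum.cong) auto
  also have "sum a X = 2"
    using p(2) q(2) by (simp add: a_def sum.distrib flip: sum_divide_distrib sum_distrib_left)
  also have "sum b X = (\<Sum>x\<in>X. p x * ln (p x / q x))"
    using p(2) q(2) by (simp add: b_def sum.distrib sum_subtractf)
  finally show ?thesis .
qed

text \<open>Over a finite type both measures have densities with respect to counting measure, so the
  divergence becomes the finite sum of \<open>pinsker_sum\<close>.\<close>

lemma pinsker:
  fixes p :: "'b::finite pmf"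
  assumes Q: "Q \<in> space (prob_algebra (count_space UNIV))"
    and kl: "kl (measure_pmf p) Q \<le> ereal c"
  shows "(\<Sum>x\<in>UNIV. \<bar>pmf p x - measure Q {x}\<bar>)\<^sup>2 \<le> 2 * c"
proof -
  have [simp]: "sets Q = UNIV" and "prob_space Q"
    using Q by (auto simp: space_prob_algebra)
  interpret Q: prob_space Q by fact
  have [simp]: "space Q = UNIV" using sets_eq_imp_space_eq[of Q "count_space UNIV"] by simp
  \<comment> \<open>Without absolute continuity \<open>kl\<close> would be infinite and could not
    lie below the real \<open>c\<close>.\<close>
  have ac: "absolutely_continuous Q (measure_pmf p)"
    using kl by (auto simp: kl_def split: if_splits)
  have pq: "pmf p x = 0" if "measure Q {x} = 0" for x
  proof -
    have "{x} \<in> null_sets (measure_pmf p)"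
      using ac that by (auto simp: absolutely_continuous_def null_sets_def Q.emeasure_eq_measure)
    then show ?thesis by (auto simp: null_sets_def emeasure_pmf_single)
  qed
  have Q_density: "Q = density (count_space UNIV) (\<lambda>x. ennreal (measure Q {x}))"
    by (rule measure_eqI_finite[of _ UNIV])
       (auto simp: emeasure_density Q.emeasure_eq_measure nn_integral_count_space_finite
             nn_integral_count_space_indicator[symmetric] indicator_def if_distrib
             nn_integral_count_space_finite cong: if_cong)
  interpret S: sigma_finite_measure "count_space (UNIV :: 'b set)"
    by (rule sigma_finite_measure_count_space_finite) simp
  have "KL_divergence (exp 1) Q (measure_pmf p) =
      KL_divergence (exp 1) (density (count_space UNIV) (\<lambda>x. ennreal (measure Q {x})))
        (density (count_space UNIV) (\<lambda>x. ennreal (pmf p x)))"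
    using Q_density measure_pmf_eq_density[of p] by simp
  also have "\<dots> = (\<integral>x. pmf p x * log (exp 1) (pmf p x / measure Q {x}) \<partial>count_space UNIV)"
    by (rule S.KL_density_density) (auto simp: pq)
  also have "\<dots> = (\<Sum>x\<in>UNIV. pmf p x * ln (pmf p x / measure Q {x}))"
    by (simp add: lebesgue_integral_count_space_finite log_def)
  finally have "(\<Sum>x\<in>UNIV. pmf p x * ln (pmf p x / measure Q {x})) \<le> c"
    using kl ac by (simp add: kl_def)
  moreover have "(\<Sum>x\<in>UNIV. measure Q {x}) = 1"
    using Q.finite_measure_finite_Union[of UNIV "\<lambda>x. {x}"] Q.prob_space
    by (simp add: disjoint_family_on_def)
  ultimately show ?thesis
    using pinsker_sum[of UNIV "pmf p" "\<lambda>x. measure Q {x}"] pq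
    by (simp add: sum_pmf_eq_1)
qed

section \<open>The Bellman equation of a stationary policy\<close>

lemma (in prob_space) abs_expectation_le:
  fixes f :: "'a \<Rightarrow> real"
  assumes f: "f \<in> borel_measurable M" and B: "AE x in M. \<bar>f x\<bar> \<le> B"
  shows "\<bar>expectation f\<bar> \<le> B"
proof -
  have "integrable M f" using f B by (intro integrable_const_bound[where B=B]) auto
  then have "expectation (\<lambda>x. \<bar>f x\<bar>) \<le> expectation (\<lambda>_. B)"
    using B by (intro integral_mono_AE) auto
  also have "\<dots> = B" by (simp add: prob_space)
  finally show ?thesis using integral_abs_bound[of M f] by linarith
qed

text \<open>The last extension step \<open>eP n\<close> appends a draw from \<open>P n\<close> to
  the history as coordinate \<open>n\<close>; projecting to that coordinate leaves just the
  draw.\<close>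

lemma (in Ionescu_Tulcea) distr_C_component:
  "distr (C 0 (Suc n) (\<lambda>_. undefined)) (M n) (\<lambda>\<omega>. \<omega> n) = C 0 n (\<lambda>_. undefined) \<bind> P n"
proof -
  let ?u = "\<lambda>_::nat. undefined :: 'a"
  have u: "?u \<in> space (PiM {0..<0} M)" by (simp add: space_PiM)
  have ne: "space (C 0 n ?u) \<noteq> {}"
    using prob_space_C[OF u, of n] by (rule prob_space.not_empty)
  have sC: "sets (C 0 n ?u) = sets (PiM {0..<n} M)" using sets_C[OF u, of n] by (simp only: add_0)
  have "distr (C 0 (Suc n) ?u) (M n) (\<lambda>\<omega>. \<omega> n)
      = C 0 n ?u \<bind> (\<lambda>\<omega>. distr (eP n \<omega>) (M n) (\<lambda>\<omega>. \<omega> n))"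
    using measurable_eP[of n] ne
    by (simp, intro distr_bind[where K="PiM {0..<Suc n} M"])
       (simp_all add: measurable_cong_sets[OF sC refl] measurable_component_singleton)
  also have "\<dots> = C 0 n ?u \<bind> P n"
  proof (rule bind_cong[OF refl])
    fix \<omega> assume "\<omega> \<in> space (C 0 n ?u)"
    then have \<omega>: "\<omega> \<in> space (PiM {0..<n} M)" using sets_eq_imp_space_eq[OF sC] by simp
    have "distr (eP n \<omega>) (M n) (\<lambda>\<omega>. \<omega> n) = distr (P n \<omega>) (M n) (\<lambda>x. x)"
      unfolding eP_def
      by (subst distr_distr)
         (auto simp: comp_def sets_P[OF \<omega>] measurable_cong_sets[OF sets_P[OF \<omega>] refl]
               intro!: measurable_fun_upd[where J="{0..<n}"] measurable_const \<omega>)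
    also have "\<dots> = P n \<omega>" by (rule distr_id2) (simp add: sets_P[OF \<omega>])
    finally show "distr (eP n \<omega>) (M n) (\<lambda>\<omega>. \<omega> n) = P n \<omega>" .
  qed
  finally show ?thesis .
qed

text \<open>The limit has \<open>CI {n}\<close> as its marginal on \<open>{n}\<close>, and
  \<open>CI {n}\<close> is itself a projection of the law of the first \<open>Suc n\<close>
  coordinates, whose last coordinate is known.\<close>

lemma (in Ionescu_Tulcea) distr_lim_component:
  "distr PF.lim (M n) (\<lambda>\<omega>. \<omega> n) = C 0 n (\<lambda>_. undefined) \<bind> P n"
proof -
  have up: "up_to {n} = Suc n"
    using up_to_less[of "{n}" n] up_to_iff[of "{n}" "Suc n"] by auto
  have sC: "sets (C 0 (Suc n) (\<lambda>_. undefined)) = sets (PiM {0..<Suc n} M)"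
    using sets_C[of "\<lambda>_. undefined" 0 "Suc n"] by (simp add: space_PiM)
  have "distr PF.lim (M n) (\<lambda>\<omega>. \<omega> n)
      = distr (distr PF.lim (PiM {n} M) (\<lambda>x. restrict x {n})) (M n) (\<lambda>\<omega>. \<omega> n)"
    by (subst distr_distr)
       (auto simp: comp_def measurable_cong_sets[OF PF.sets_lim refl]
             intro!: measurable_restrict measurable_component_singleton)
  also have "\<dots> = distr (CI {n}) (M n) (\<lambda>\<omega>. \<omega> n)"
    by (simp add: distr_lim)
  also have "\<dots> = distr (C 0 (Suc n) (\<lambda>_. undefined)) (M n) (\<lambda>\<omega>. \<omega> n)"
    unfolding CI_def up
    by (subst distr_distr)
       (auto simp: comp_def measurable_cong_sets[OF sC refl] simp del: C.simps
             intro!: measurable_restrict measurable_component_singleton)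
  finally show ?thesis by (simp only: distr_C_component)
qed

lemma bind_in_prob_algebra:
  assumes "A \<in> space (prob_algebra M)" "f \<in> M \<rightarrow>\<^sub>M prob_algebra N"
  shows "A \<bind> f \<in> space (prob_algebra N)"
proof -
  \<comment> \<open>A single measure is read as a constant kernel on \<open>unit\<close>, so that
    the rule for binding kernels applies.\<close>
  have "(\<lambda>_. A) \<in> count_space (UNIV :: unit set) \<rightarrow>\<^sub>M prob_algebra M"
    using assms(1) by simp
  from measurable_space[OF measurable_bind_prob_space[OF this assms(2)]] show ?thesis by simp
qed

text \<open>The time-homogeneous Markov kernel behind \<open>step_kernel\<close>: at
  \<open>Suc t\<close> the latter is \<open>step_from\<close> applied to coordinate \<open>t\<close>
  of the history.\<close>

definition step_from ::
  "('s, 'a) mdp \<Rightarrow> ('s \<Rightarrow> 'a measure) \<Rightarrow> 's \<times> 'a \<times> real \<Rightarrow> ('s \<times> 'a \<times> real) measure" where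
  "step_from M \<pi> x = measure_pmf (transition M (fst x) (fst (snd x))) \<bind> step_law M \<pi>"

definition mean_reward :: "('s, 'a) mdp \<Rightarrow> 's \<Rightarrow> real" where
  "mean_reward M s = (\<integral>r. r \<partial>reward M s)"

definition policy_transition :: "('s, 'a) mdp \<Rightarrow> ('s \<Rightarrow> 'a measure) \<Rightarrow> 's \<Rightarrow> 's \<Rightarrow> real" where
  "policy_transition M \<pi> s s' = (\<integral>a. pmf (transition M s a) s' \<partial>\<pi> s)"

text \<open>The transition matrix of the induced Markov chain, acting as an operator on vectors of
  state values.\<close>

definition expect_next ::
  "('s::finite, 'a) mdp \<Rightarrow> ('s \<Rightarrow> 'a measure) \<Rightarrow> ('s \<Rightarrow> real) \<Rightarrow> 's \<Rightarrow> real" where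
  "expect_next M \<pi> w s = (\<Sum>s'\<in>UNIV. policy_transition M \<pi> s s' * w s')"

section \<open>The trajectory measure and its one-time marginals\<close>

locale mdp_policy =
  fixes M :: "('s::finite, 'a) mdp" and \<pi> :: "'s \<Rightarrow> 'a measure"
  assumes mdp: "is_mdp M" and policy: "\<pi> \<in> policies M"
begin

lemma discount_nonneg: "0 \<le> discount M" and discount_less_1: "discount M < 1"
  using mdp by (auto simp: is_mdp_def)

lemma prob_space_policy: "prob_space (\<pi> s)"
  and sets_policy [measurable_cong]: "sets (\<pi> s) = sets (count_space (actions M))"
  using policy by (auto simp: policies_def space_prob_algebra)

lemma space_policy: "space (\<pi> s) = actions M"
  using sets_eq_imp_space_eq[OF sets_policy, of s] by simp

lemma prob_space_reward: "prob_space (reward M s)"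
  and sets_reward [measurable_cong]: "sets (reward M s) = sets borel"
  and AE_reward: "AE r in reward M s. \<bar>r\<bar> \<le> rmax M"
  using mdp by (auto simp: is_mdp_def space_prob_algebra)

text \<open>A probability measure cannot be concentrated on an empty interval;
  \<open>undefined\<close> serves as an arbitrary state.\<close>

lemma rmax_nonneg: "0 \<le> rmax M"
proof -
  interpret prob_space "reward M undefined" by (rule prob_space_reward)
  have "AE r in reward M undefined. 0 \<le> rmax M"
    using AE_reward[of undefined] by eventually_elim linarith
  then show ?thesis by simp
qed

lemma step_law_in_prob_algebra: "step_law M \<pi> s \<in> space (prob_algebra (step_space M))"
  unfolding step_law_def step_space_def space_prob_algebra
  by (auto intro!: prob_space_pair prob_space_return prob_space_policy prob_space_reward
      sets_pair_measure_cong sets_policy sets_reward)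

lemma prob_space_step_law: "prob_space (step_law M \<pi> s)"
  and sets_step_law [measurable_cong]: "sets (step_law M \<pi> s) = sets (step_space M)"
  using step_law_in_prob_algebra[of s] by (auto simp: space_prob_algebra)

lemma measurable_step_law [measurable]:
  "step_law M \<pi> \<in> count_space UNIV \<rightarrow>\<^sub>M prob_algebra (step_space M)"
  using step_law_in_prob_algebra by simp

text \<open>The state type is countable, so the state may be fixed; the action space carries its
  power set, so any dependence on the action is measurable.\<close>

lemma measurable_transition:
  "(\<lambda>x. measure_pmf (transition M (fst x) (fst (snd x))))
     \<in> step_space M \<rightarrow>\<^sub>M prob_algebra (count_space UNIV)"
  unfolding step_space_def
proof (rule measurable_pair_measure_countable1)
  fix s :: 's
  have "(\<lambda>a. measure_pmf (transition M s a))
      \<in> count_space (actions M) \<rightarrow>\<^sub>M prob_algebra (count_space UNIV)"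
    by (auto simp: space_prob_algebra measure_pmf.prob_space_axioms)
  from measurable_compose[OF measurable_fst this]
  show "(\<lambda>y. measure_pmf (transition M (fst (s, y)) (fst (snd (s, y)))))
      \<in> count_space (actions M) \<Otimes>\<^sub>M borel \<rightarrow>\<^sub>M prob_algebra (count_space UNIV)"
    by simp
qed simp

lemma measurable_step_from [measurable]:
  "step_from M \<pi> \<in> step_space M \<rightarrow>\<^sub>M prob_algebra (step_space M)"
  unfolding step_from_def[abs_def]
  by (rule measurable_bind_prob_space[OF measurable_transition measurable_step_law])

text \<open>This gives access to the Ionescu-Tulcea theory for \<open>trajectory\<close>. The kernel
  is constant at time 0 and factors through one coordinate later, so its measurability comes from
  \<open>step_law\<close> and \<open>step_from\<close>.\<close>

lemma Ionescu_Tulcea_step_kernel: "Ionescu_Tulcea (step_kernel M \<pi> s) (\<lambda>_. step_space M)"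
proof -
  have K: "step_kernel M \<pi> s t \<in> PiM {0..<t} (\<lambda>_. step_space M) \<rightarrow>\<^sub>M prob_algebra (step_space M)" for t
  proof (cases t)
    case 0
    then have "step_kernel M \<pi> s t = (\<lambda>_. step_law M \<pi> s)" by (simp add: fun_eq_iff)
    then show ?thesis using step_law_in_prob_algebra by simp
  next
    case (Suc n)
    then have "step_kernel M \<pi> s t = (\<lambda>\<omega>. step_from M \<pi> (\<omega> n))"
      by (auto simp: fun_eq_iff step_from_def split: prod.split)
    moreover have "(\<lambda>\<omega>. \<omega> n) \<in> PiM {0..<t} (\<lambda>_. step_space M) \<rightarrow>\<^sub>M step_space M"
      using Suc by (intro measurable_component_singleton) auto
    ultimately show ?thesis using measurable_compose measurable_step_from by metis
  qed
  show ?thesis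
  proof (rule Ionescu_Tulcea.intro)
    show "step_kernel M \<pi> s t \<in> PiM {0..<t} (\<lambda>_. step_space M) \<rightarrow>\<^sub>M subprob_algebra (step_space M)" for t
      by (rule measurable_prob_algebraD[OF K])
    fix t :: nat and \<omega> assume "\<omega> \<in> space (PiM {0..<t} (\<lambda>_. step_space M))"
    from measurable_space[OF K this] show "prob_space (step_kernel M \<pi> s t \<omega>)"
      by (simp add: space_prob_algebra)
  qed
qed

definition marginal :: "'s \<Rightarrow> nat \<Rightarrow> ('s \<times> 'a \<times> real) measure" where
  "marginal s t = distr (trajectory M \<pi> s) (step_space M) (\<lambda>\<omega>. \<omega> t)"

lemma sets_trajectory [measurable_cong]:
  "sets (trajectory M \<pi> s) = sets (PiM UNIV (\<lambda>_. step_space M))"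
proof -
  interpret IT: Ionescu_Tulcea "step_kernel M \<pi> s" "\<lambda>_. step_space M"
    by (rule Ionescu_Tulcea_step_kernel)
  show ?thesis unfolding trajectory_def by (rule IT.PF.sets_lim)
qed

lemma measurable_trajectory_component [measurable]:
  "(\<lambda>\<omega>. \<omega> t) \<in> trajectory M \<pi> s \<rightarrow>\<^sub>M step_space M"
  by (simp add: measurable_cong_sets[OF sets_trajectory refl] measurable_component_singleton)

lemma marginal_0: "marginal s 0 = step_law M \<pi> s"
proof -
  interpret IT: Ionescu_Tulcea "step_kernel M \<pi> s" "\<lambda>_. step_space M"
    by (rule Ionescu_Tulcea_step_kernel)
  have "marginal s 0 = IT.C 0 0 (\<lambda>_. undefined) \<bind> step_kernel M \<pi> s 0"
    unfolding marginal_def trajectory_def by (rule IT.distr_lim_component)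
  also have "\<dots> = step_kernel M \<pi> s 0 (\<lambda>_. undefined)"
    unfolding IT.C.simps by (rule bind_return[OF IT.P[of 0]]) (simp add: space_PiM)
  finally show ?thesis by simp
qed

text \<open>The Markov property: the kernel at time \<open>Suc t\<close> reads only coordinate
  \<open>t\<close>, so the integral over histories factors through the law of that
  coordinate.\<close>

lemma marginal_Suc: "marginal s (Suc t) = marginal s t \<bind> step_from M \<pi>"
proof -
  interpret IT: Ionescu_Tulcea "step_kernel M \<pi> s" "\<lambda>_. step_space M"
    by (rule Ionescu_Tulcea_step_kernel)
  let ?C = "IT.C 0 (Suc t) (\<lambda>_. undefined)"
  have u: "(\<lambda>_::nat. undefined) \<in> space (PiM {0..<0} (\<lambda>_. step_space M))" by (simp add: space_PiM)
  have sC: "sets ?C = sets (PiM {0..<Suc t} (\<lambda>_. step_space M))"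
    using IT.sets_C[OF u, of "Suc t"] by (simp only: add_0)
  have "marginal s (Suc t) = ?C \<bind> step_kernel M \<pi> s (Suc t)"
    unfolding marginal_def trajectory_def by (rule IT.distr_lim_component)
  also have "step_kernel M \<pi> s (Suc t) = (\<lambda>\<omega>. step_from M \<pi> (\<omega> t))"
    by (auto simp: fun_eq_iff step_from_def split: prod.split)
  also have "?C \<bind> (\<lambda>\<omega>. step_from M \<pi> (\<omega> t)) = distr ?C (step_space M) (\<lambda>\<omega>. \<omega> t) \<bind> step_from M \<pi>"
    by (rule bind_distr[symmetric, OF _ measurable_prob_algebraD[OF measurable_step_from]])
       (use IT.prob_space_C[OF u, of "Suc t"] in
         \<open>auto simp: measurable_cong_sets[OF sC refl] simp del: IT.C.simps
          intro!: measurable_component_singleton dest: prob_space.not_empty\<close>)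
  also have "distr ?C (step_space M) (\<lambda>\<omega>. \<omega> t) = marginal s t"
    unfolding marginal_def trajectory_def IT.distr_lim_component by (rule IT.distr_C_component)
  finally show ?thesis .
qed

lemma marginal_in_prob_algebra: "marginal s t \<in> space (prob_algebra (step_space M))"
proof (induction t)
  case 0
  then show ?case by (simp add: marginal_0 step_law_in_prob_algebra)
next
  case (Suc t)
  then show ?case
    unfolding marginal_Suc by (rule bind_in_prob_algebra[OF _ measurable_step_from])
qed

text \<open>A measurable image has the same total mass, and the image at time 0 is already known to
  be a probability measure.\<close>

lemma prob_space_trajectory: "prob_space (trajectory M \<pi> s)"
proof (rule prob_space_distrD[OF measurable_trajectory_component[of 0 s]])
  show "prob_space (distr (trajectory M \<pi> s) (step_space M) (\<lambda>\<omega>. \<omega> 0))"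
    using marginal_in_prob_algebra[of s 0] by (simp add: space_prob_algebra marginal_def)
qed

text \<open>Fubini twice, with integrability from the bound \<open>B\<close>; the state factor is a
  point mass.\<close>

lemma integral_step_law:
  assumes [measurable]: "f \<in> borel_measurable (step_space M)"
    and B: "\<And>x. x \<in> space (step_space M) \<Longrightarrow> \<bar>f x\<bar> \<le> B"
  shows "(\<integral>x. f x \<partial>step_law M \<pi> s) = (\<integral>a. \<integral>r. f (s, a, r) \<partial>reward M s \<partial>\<pi> s :: real)"
proof -
  interpret R: prob_space "reward M s" by (rule prob_space_reward)
  interpret P: prob_space "\<pi> s" by (rule prob_space_policy)
  interpret S: prob_space "return (count_space UNIV) s" by (rule prob_space_return) simp
  interpret PR: pair_prob_space "\<pi> s" "reward M s" ..
  interpret SPR: pair_prob_space "return (count_space UNIV) s" "\<pi> s \<Otimes>\<^sub>M reward M s" ..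
  interpret L: prob_space "step_law M \<pi> s" by (rule prob_space_step_law)
  have sp: "space (step_law M \<pi> s) = space (step_space M)"
    using sets_eq_imp_space_eq[OF sets_step_law] .
  have sPR: "sets (\<pi> s \<Otimes>\<^sub>M reward M s) = sets (count_space (actions M) \<Otimes>\<^sub>M borel)"
    by (intro sets_pair_measure_cong sets_policy sets_reward)
  have m: "(\<lambda>y. f (s, y)) \<in> borel_measurable (\<pi> s \<Otimes>\<^sub>M reward M s)"
    unfolding measurable_cong_sets[OF sPR refl]
    by (rule measurable_compose[OF measurable_Pair1'[of s "count_space UNIV"] assms(1)[unfolded step_space_def]]) simp
  have int1: "integrable (\<pi> s \<Otimes>\<^sub>M reward M s) (\<lambda>y. f (s, y))"
    by (rule PR.P.integrable_const_bound[where B=B])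
       (use m B sets_eq_imp_space_eq[OF sPR] in
         \<open>auto intro!: AE_I2 simp: step_space_def space_pair_measure\<close>)
  have "integrable (step_law M \<pi> s) f"
    by (rule L.integrable_const_bound[where B=B])
       (use B in \<open>auto intro!: AE_I2 simp: sp measurable_cong_sets[OF sets_step_law refl]\<close>)
  then have "(\<integral>x. f x \<partial>step_law M \<pi> s)
      = (\<integral>s'. \<integral>y. f (s', y) \<partial>(\<pi> s \<Otimes>\<^sub>M reward M s) \<partial>return (count_space UNIV) s)"
    unfolding step_law_def by (rule SPR.integral_fst'[symmetric])
  also have "\<dots> = (\<integral>y. f (s, y) \<partial>(\<pi> s \<Otimes>\<^sub>M reward M s))"
    by (rule integral_return) auto
  also have "\<dots> = (\<integral>a. \<integral>r. f (s, a, r) \<partial>reward M s \<partial>\<pi> s)"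
    using PR.integral_fst'[OF int1] by simp
  finally show ?thesis .
qed

section \<open>The transition operator of a policy\<close>

lemma policy_transition_nonneg: "0 \<le> policy_transition M \<pi> s s'"
  unfolding policy_transition_def by (simp add: integral_nonneg_AE)

lemma integrable_policy:
  fixes f :: "'a \<Rightarrow> real"
  assumes "\<And>a. a \<in> actions M \<Longrightarrow> \<bar>f a\<bar> \<le> B"
  shows "integrable (\<pi> s) f"
proof -
  interpret prob_space "\<pi> s" by (rule prob_space_policy)
  show ?thesis
    by (rule integrable_const_bound[where B=B])
       (use assms in \<open>auto intro!: AE_I2 simp: space_policy measurable_cong_sets[OF sets_policy refl]\<close>)
qed

lemma integrable_transition: "integrable (\<pi> s) (\<lambda>a. pmf (transition M s a) s')"
  by (rule integrable_policy[where B=1]) (simp add: pmf_le_1)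

lemma expect_next_eq_integral:
  "expect_next M \<pi> w s = (\<integral>a. (\<Sum>s'\<in>UNIV. pmf (transition M s a) s' * w s') \<partial>\<pi> s)"
  unfolding expect_next_def policy_transition_def
  by (subst Bochner_Integration.integral_sum) (auto intro: integrable_transition)

lemma sum_policy_transition: "(\<Sum>s'\<in>UNIV. policy_transition M \<pi> s s') = 1"
proof -
  interpret prob_space "\<pi> s" by (rule prob_space_policy)
  show ?thesis
    using expect_next_eq_integral[of "\<lambda>_. 1" s]
    by (simp add: expect_next_def sum_pmf_eq_1 prob_space)
qed

lemma expect_next_mono:
  assumes "\<And>s. w s \<le> w' s"
  shows "expect_next M \<pi> w s \<le> expect_next M \<pi> w' s"
  unfolding expect_next_def
  by (intro sum_mono mult_left_mono assms policy_transition_nonneg)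

lemma expect_next_const: "expect_next M \<pi> (\<lambda>_. c) s = c"
  using sum_policy_transition[of s] by (simp add: expect_next_def flip: sum_distrib_right)

lemma expect_next_le:
  assumes "\<And>s. w s \<le> c"
  shows "expect_next M \<pi> w s \<le> c"
  using expect_next_mono[of w "\<lambda>_. c" s] assms by (simp add: expect_next_const)

lemma expect_next_diff:
  "expect_next M \<pi> (\<lambda>s. w s - w' s) s = expect_next M \<pi> w s - expect_next M \<pi> w' s"
  by (simp add: expect_next_def right_diff_distrib sum_subtractf)

lemma abs_expect_next_le:
  assumes "\<And>s. \<bar>w s\<bar> \<le> c"
  shows "\<bar>expect_next M \<pi> w s\<bar> \<le> c"
proof -
  have "- c \<le> w s" "w s \<le> c" for s using assms[of s] by auto
  then show ?thesis
    using expect_next_mono[of "\<lambda>_. - c" w s] expect_next_mono[of w "\<lambda>_. c" s]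
    by (simp add: expect_next_const abs_le_iff)
qed

lemma abs_expect_next_funpow_le:
  assumes "\<And>s. \<bar>w s\<bar> \<le> c"
  shows "\<bar>(expect_next M \<pi> ^^ t) w s\<bar> \<le> c"
  using assms by (induction t arbitrary: s) (auto intro: abs_expect_next_le)

section \<open>Marginal expectations as powers of the transition operator\<close>

lemma integral_step_from:
  fixes f :: "'s \<times> 'a \<times> real \<Rightarrow> real"
  assumes f: "f \<in> borel_measurable (step_space M)"
    and B: "\<And>x. x \<in> space (step_space M) \<Longrightarrow> \<bar>f x\<bar> \<le> B"
  shows "(\<integral>y. f y \<partial>step_from M \<pi> x) = (\<Sum>s'\<in>UNIV. pmf (transition M (fst x) (fst (snd x))) s'
      * (\<integral>y. f y \<partial>step_law M \<pi> s'))"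
proof -
  have "(\<integral>y. f y \<partial>step_from M \<pi> x)
      = (\<integral>s'. \<integral>y. f y \<partial>step_law M \<pi> s' \<partial>measure_pmf (transition M (fst x) (fst (snd x))))"
    unfolding step_from_def
    using measurable_prob_algebraD[OF measurable_step_law] prob_space_step_law
    by (intro integral_bind[OF f B, where B'=1])
       (auto simp: prob_space.emeasure_space_1 measure_pmf.finite_measure_axioms)
  then show ?thesis by (simp add: integral_measure_pmf[of UNIV])
qed

text \<open>The one-step expectation of a bounded measurable function is again bounded and
  measurable, so it can replace that function in an induction over time.\<close>

lemma
  fixes f :: "'s \<times> 'a \<times> real \<Rightarrow> real"
  assumes f: "f \<in> borel_measurable (step_space M)"
    and B: "\<And>x. x \<in> space (step_space M) \<Longrightarrow> \<bar>f x\<bar> \<le> B"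
  shows measurable_integral_step_from:
      "(\<lambda>x. \<integral>y. f y \<partial>step_from M \<pi> x) \<in> borel_measurable (step_space M)"
    and abs_integral_step_from_le:
      "x \<in> space (step_space M) \<Longrightarrow> \<bar>\<integral>y. f y \<partial>step_from M \<pi> x\<bar> \<le> B"
proof -
  show "(\<lambda>x. \<integral>y. f y \<partial>step_from M \<pi> x) \<in> borel_measurable (step_space M)"
    by (rule measurable_compose[OF measurable_prob_algebraD[OF measurable_step_from]
          integral_measurable_subprob_algebra[OF f]])
next
  assume x: "x \<in> space (step_space M)"
  have K: "step_from M \<pi> x \<in> space (prob_algebra (step_space M))"
    using measurable_space[OF measurable_step_from x] .
  then have sets: "sets (step_from M \<pi> x) = sets (step_space M)" by (simp add: space_prob_algebra)
  interpret prob_space "step_from M \<pi> x" using K by (simp add: space_prob_algebra)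
  show "\<bar>\<integral>y. f y \<partial>step_from M \<pi> x\<bar> \<le> B"
    using f B sets_eq_imp_space_eq[OF sets]
    by (intro abs_expectation_le AE_I2) (simp_all add: measurable_cong_sets[OF sets refl])
qed

text \<open>The next state depends on the current state and action only, so the integral over the
  current reward is that of a constant.\<close>

lemma integral_step_law_step_from:
  fixes f :: "'s \<times> 'a \<times> real \<Rightarrow> real"
  assumes f: "f \<in> borel_measurable (step_space M)"
    and B: "\<And>x. x \<in> space (step_space M) \<Longrightarrow> \<bar>f x\<bar> \<le> B"
  shows "(\<integral>x. \<integral>y. f y \<partial>step_from M \<pi> x \<partial>step_law M \<pi> s)
    = expect_next M \<pi> (\<lambda>s'. \<integral>y. f y \<partial>step_law M \<pi> s') s"
proof -
  interpret R: prob_space "reward M s" by (rule prob_space_reward)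
  show ?thesis
    using integral_step_law[OF measurable_integral_step_from[OF assms] abs_integral_step_from_le[OF assms]]
    by (simp add: integral_step_from[OF assms] expect_next_eq_integral R.prob_space)
qed

text \<open>Induction with \<open>f\<close> general: the last step is absorbed into \<open>f\<close>
  by passing to its expectation under \<open>step_from\<close>. The operator then appears innermost,
  and \<open>funpow_swap1\<close> moves it outside.\<close>

lemma integral_marginal:
  fixes f :: "'s \<times> 'a \<times> real \<Rightarrow> real"
  assumes f: "f \<in> borel_measurable (step_space M)"
    and B: "\<And>x. x \<in> space (step_space M) \<Longrightarrow> \<bar>f x\<bar> \<le> B"
  shows "(\<integral>x. f x \<partial>marginal s t) = (expect_next M \<pi> ^^ t) (\<lambda>s. \<integral>x. f x \<partial>step_law M \<pi> s) s"
  using assms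
proof (induction t arbitrary: f)
  case 0
  then show ?case by (simp add: marginal_0)
next
  case (Suc t)
  let ?g = "\<lambda>x. \<integral>y. f y \<partial>step_from M \<pi> x"
  have m: "sets (marginal s t) = sets (step_space M)" "prob_space (marginal s t)"
    using marginal_in_prob_algebra[of s t] by (auto simp: space_prob_algebra)
  have sf': "step_from M \<pi> \<in> marginal s t \<rightarrow>\<^sub>M subprob_algebra (step_space M)"
    using measurable_prob_algebraD[OF measurable_step_from]
    by (simp add: measurable_cong_sets[OF m(1) refl])
  have "(\<integral>x. f x \<partial>marginal s (Suc t)) = (\<integral>x. ?g x \<partial>marginal s t)"
    unfolding marginal_Suc
    using measurable_space[OF measurable_step_from] sets_eq_imp_space_eq[OF m(1)] m(2)
    by (intro integral_bind[OF Suc.prems sf', where B'=1])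
       (auto simp: space_prob_algebra prob_space.emeasure_space_1 prob_space_def intro!: AE_I2)
  also have "\<dots> = (expect_next M \<pi> ^^ t) (\<lambda>s. \<integral>x. ?g x \<partial>step_law M \<pi> s) s"
    by (rule Suc.IH[OF measurable_integral_step_from[OF Suc.prems]
          abs_integral_step_from_le[OF Suc.prems]])
  also have "(\<lambda>s. \<integral>x. ?g x \<partial>step_law M \<pi> s) = expect_next M \<pi> (\<lambda>s. \<integral>x. f x \<partial>step_law M \<pi> s)"
    using integral_step_law_step_from[OF Suc.prems] by auto
  finally show ?case by (simp add: funpow_swap1)
qed

text \<open>The indicator of an oversized reward has integral 0 under \<open>step_law\<close> from
  every state, hence under every marginal; countably many times give one null set.\<close>

lemma AE_trajectory_reward: "AE \<omega> in trajectory M \<pi> s. \<forall>t. \<bar>snd (snd (\<omega> t))\<bar> \<le> rmax M"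
proof -
  have "AE \<omega> in trajectory M \<pi> s. \<bar>snd (snd (\<omega> t))\<bar> \<le> rmax M" for t
  proof -
    let ?A = "{x \<in> space (step_space M). \<not> \<bar>snd (snd x)\<bar> \<le> rmax M}"
    have A: "?A \<in> sets (step_space M)" unfolding step_space_def by measurable
    have step: "(\<integral>x. indicator ?A x \<partial>step_law M \<pi> s) = (0::real)" for s
    proof -
      have "(\<integral>x. indicator ?A x \<partial>step_law M \<pi> s)
          = (\<integral>a. \<integral>r. indicator ?A (s, a, r) \<partial>reward M s \<partial>\<pi> s :: real)"
        using A by (intro integral_step_law[where B=1]) (auto simp: indicator_def)
      also have "\<dots> = (\<integral>a. 0 \<partial>\<pi> s)"
      proof (rule Bochner_Integration.integral_cong[OF refl])
        fix a
        have "AE r in reward M s. indicator ?A (s, a, r) = (0::real)"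
          using AE_reward[of s] by eventually_elim (auto simp: indicator_def)
        then show "(\<integral>r. indicator ?A (s, a, r) \<partial>reward M s) = (0::real)"
          by (rule integral_eq_zero_AE)
      qed
      finally show ?thesis by simp
    qed
    have "(\<integral>x. indicator ?A x \<partial>marginal s t)
        = (expect_next M \<pi> ^^ t) (\<lambda>s. \<integral>x. indicator ?A x \<partial>step_law M \<pi> s) s"
      using A by (intro integral_marginal[where B=1]) (auto simp: indicator_def)
    also have "\<dots> = (expect_next M \<pi> ^^ t) (\<lambda>_. 0) s" by (simp only: step)
    also have "\<dots> = 0"
      using abs_expect_next_funpow_le[of "\<lambda>_. 0" 0 t s] by simp
    finally have 0: "(\<integral>x. indicator ?A x \<partial>marginal s t) = (0::real)" .
    have m: "sets (marginal s t) = sets (step_space M)" "prob_space (marginal s t)"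
      using marginal_in_prob_algebra[of s t] by (auto simp: space_prob_algebra)
    interpret prob_space "marginal s t" by (rule m)
    have "prob ?A = 0"
      using 0 A m(1) sets.sets_into_space[OF A] sets_eq_imp_space_eq[OF m(1)]
      by (simp add: Int_absorb1 Int_absorb2)
    then have "AE x in marginal s t. \<bar>snd (snd x)\<bar> \<le> rmax M"
      using A m(1) sets_eq_imp_space_eq[OF m(1)]
      by (intro AE_I[where N="?A"]) (auto simp: emeasure_eq_measure)
    then show ?thesis
      unfolding marginal_def by (rule AE_distrD[OF measurable_trajectory_component])
  qed
  then show ?thesis by (simp add: AE_all_countable)
qed

text \<open>Sum and expectation are exchanged under domination by a geometric series, and each
  expected reward is a power of the transition operator applied to the mean rewards.\<close>

lemma state_value_eq:
  "state_value M \<pi> s = (\<Sum>t. discount M ^ t * (expect_next M \<pi> ^^ t) (mean_reward M) s)"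
proof -
  \<comment> \<open>Rewards are bounded only almost surely, whereas \<open>integral_marginal\<close>
    wants a bound everywhere; truncation supplies it and changes rewards only on a null set.\<close>
  define clamp where "clamp r = max (- rmax M) (min (rmax M) r)" for r
  have clamp_bound: "\<bar>clamp r\<bar> \<le> rmax M" for r using rmax_nonneg by (auto simp: clamp_def)
  have [measurable]: "clamp \<in> borel_measurable borel" unfolding clamp_def by measurable
  have clamp_step: "(\<lambda>x. clamp (snd (snd x))) \<in> borel_measurable (step_space M)"
    unfolding step_space_def by measurable
  interpret T: prob_space "trajectory M \<pi> s" by (rule prob_space_trajectory)
  have clamp_traj: "(\<lambda>\<omega>. clamp (snd (snd (\<omega> t)))) \<in> borel_measurable (trajectory M \<pi> s)" for t
    by (rule measurable_compose[OF measurable_trajectory_component clamp_step])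
  have clamp_step_law: "(\<integral>x. clamp (snd (snd x)) \<partial>step_law M \<pi> s) = mean_reward M s" for s
  proof -
    interpret P: prob_space "\<pi> s" by (rule prob_space_policy)
    have "(\<integral>x. clamp (snd (snd x)) \<partial>step_law M \<pi> s) = (\<integral>r. clamp r \<partial>reward M s)"
      using integral_step_law[OF clamp_step clamp_bound] by (simp add: P.prob_space)
    also have "\<dots> = (\<integral>r. r \<partial>reward M s)"
      using AE_reward[of s] by (intro integral_cong_AE) (auto simp: clamp_def)
    finally show ?thesis by (simp add: mean_reward_def)
  qed
  have E: "(\<integral>\<omega>. clamp (snd (snd (\<omega> t))) \<partial>trajectory M \<pi> s)
      = (expect_next M \<pi> ^^ t) (mean_reward M) s" for t
    using integral_marginal[OF clamp_step clamp_bound, of s t]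
    unfolding marginal_def integral_distr[OF measurable_trajectory_component clamp_step]
    by (simp add: clamp_step_law)
  have int: "integrable (trajectory M \<pi> s) (\<lambda>\<omega>. clamp (snd (snd (\<omega> t))))" for t
    using clamp_traj clamp_bound by (intro T.integrable_const_bound[where B="rmax M"]) auto
  have geometric: "summable (\<lambda>t. discount M ^ t * rmax M)"
    using discount_nonneg discount_less_1 by (intro summable_mult2 summable_geometric) simp
  have term_bound: "norm (discount M ^ t * clamp r) \<le> discount M ^ t * rmax M" for t r
    using clamp_bound[of r] discount_nonneg by (auto simp: abs_mult intro!: mult_left_mono)
  have "state_value M \<pi> s
      = (\<integral>\<omega>. (\<Sum>t. discount M ^ t * clamp (snd (snd (\<omega> t)))) \<partial>trajectory M \<pi> s)"
    unfolding state_value_def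
  proof (rule integral_cong_AE)
    have [measurable]: "(\<lambda>\<omega>. snd (snd (\<omega> t))) \<in> borel_measurable (trajectory M \<pi> s)" for t
      by (rule measurable_compose[OF measurable_trajectory_component]) (simp add: step_space_def)
    show "(\<lambda>\<omega>. \<Sum>t. discount M ^ t * snd (snd (\<omega> t))) \<in> borel_measurable (trajectory M \<pi> s)"
      by measurable
    show "(\<lambda>\<omega>. \<Sum>t. discount M ^ t * clamp (snd (snd (\<omega> t)))) \<in> borel_measurable (trajectory M \<pi> s)"
      by measurable
    show "AE \<omega> in trajectory M \<pi> s. (\<Sum>t. discount M ^ t * snd (snd (\<omega> t)))
        = (\<Sum>t. discount M ^ t * clamp (snd (snd (\<omega> t))))"
      using AE_trajectory_reward[of s]
    proof eventually_elim
      fix \<omega> :: "nat \<Rightarrow> 's \<times> 'a \<times> real" assume b: "\<forall>t. \<bar>snd (snd (\<omega> t))\<bar> \<le> rmax M"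
      have "clamp (snd (snd (\<omega> t))) = snd (snd (\<omega> t))" for t
        using b[rule_format, of t] by (auto simp: clamp_def)
      then show "(\<Sum>t. discount M ^ t * snd (snd (\<omega> t)))
        = (\<Sum>t. discount M ^ t * clamp (snd (snd (\<omega> t))))" by simp
    qed
  qed
  also have "\<dots> = (\<Sum>t. \<integral>\<omega>. discount M ^ t * clamp (snd (snd (\<omega> t))) \<partial>trajectory M \<pi> s)"
  proof (rule integral_suminf)
    show "integrable (trajectory M \<pi> s) (\<lambda>\<omega>. discount M ^ t * clamp (snd (snd (\<omega> t))))" for t
      using int by simp
    show "AE \<omega> in trajectory M \<pi> s. summable (\<lambda>t. norm (discount M ^ t * clamp (snd (snd (\<omega> t)))))"
      by (intro AE_I2 summable_comparison_test'[OF geometric, of 0]) (simp only: real_norm_def abs_idempotent term_bound[unfolded real_norm_def])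
    have "norm (\<integral>\<omega>. norm (discount M ^ t * clamp (snd (snd (\<omega> t)))) \<partial>trajectory M \<pi> s)
        \<le> discount M ^ t * rmax M" for t
    proof -
      have "(\<integral>\<omega>. norm (discount M ^ t * clamp (snd (snd (\<omega> t)))) \<partial>trajectory M \<pi> s)
          \<le> (\<integral>\<omega>. discount M ^ t * rmax M \<partial>trajectory M \<pi> s)"
        using int by (intro integral_mono term_bound) auto
      then show ?thesis by (simp add: T.prob_space)
    qed
    then show "summable (\<lambda>t. \<integral>\<omega>. norm (discount M ^ t * clamp (snd (snd (\<omega> t)))) \<partial>trajectory M \<pi> s)"
      by (intro summable_comparison_test'[OF geometric, of 0])
  qed
  finally show ?thesis by (simp add: E)
qed

section \<open>Convergence of the Neumann series and the Bellman equation\<close>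

lemma abs_mean_reward_le: "\<bar>mean_reward M s\<bar> \<le> rmax M"
proof -
  interpret prob_space "reward M s" by (rule prob_space_reward)
  show ?thesis
    unfolding mean_reward_def using AE_reward[of s] by (intro abs_expectation_le) simp_all
qed

text \<open>The transition operator does not increase the maximum norm, so the series is dominated
  by a geometric one.\<close>

lemma
  shows summable_state_value:
      "summable (\<lambda>t. discount M ^ t * (expect_next M \<pi> ^^ t) (mean_reward M) s)"
    and abs_state_value_le: "\<bar>state_value M \<pi> s\<bar> \<le> rmax M / (1 - discount M)"
proof -
  let ?f = "\<lambda>t. discount M ^ t * (expect_next M \<pi> ^^ t) (mean_reward M) s"
  have g: "(\<lambda>t. discount M ^ t * rmax M) sums (1 / (1 - discount M) * rmax M)"
    using discount_nonneg discount_less_1 by (intro sums_mult2 geometric_sums) simp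
  have b: "norm (?f t) \<le> discount M ^ t * rmax M" for t
    using abs_expect_next_funpow_le[OF abs_mean_reward_le] discount_nonneg
    by (auto simp: abs_mult intro!: mult_left_mono)
  show "summable ?f"
    by (rule summable_comparison_test'[OF sums_summable[OF g], of 0]) (rule b)
  have "norm (suminf ?f) \<le> (\<Sum>t. discount M ^ t * rmax M)"
    by (rule norm_suminf_le[OF b sums_summable[OF g]])
  then show "\<bar>state_value M \<pi> s\<bar> \<le> rmax M / (1 - discount M)"
    using sums_unique[OF g] by (simp add: state_value_eq)
qed

text \<open>Applying the discounted operator to the Neumann series shifts it by one index; the
  missing term at index 0 is the mean reward.\<close>

lemma state_value_bellman:
  "state_value M \<pi> s
    = mean_reward M s + discount M * expect_next M \<pi> (state_value M \<pi>) s"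
proof -
  let ?f = "\<lambda>s t. discount M ^ t * (expect_next M \<pi> ^^ t) (mean_reward M) s"
  have "(\<lambda>t. \<Sum>s'\<in>UNIV. policy_transition M \<pi> s s' * ?f s' t)
      sums (\<Sum>s'\<in>UNIV. policy_transition M \<pi> s s' * state_value M \<pi> s')"
    unfolding state_value_eq using summable_state_value
    by (intro sums_sum sums_mult summable_sums)
  then have "(\<lambda>t. discount M * (\<Sum>s'\<in>UNIV. policy_transition M \<pi> s s' * ?f s' t))
      sums (discount M * expect_next M \<pi> (state_value M \<pi>) s)"
    unfolding expect_next_def by (rule sums_mult)
  also have "(\<lambda>t. discount M * (\<Sum>s'\<in>UNIV. policy_transition M \<pi> s s' * ?f s' t)) = (\<lambda>t. ?f s (Suc t))"
    by (auto simp: expect_next_def sum_distrib_left mult_ac)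
  finally have "(\<lambda>t. ?f s (Suc t)) sums (discount M * expect_next M \<pi> (state_value M \<pi>) s)" .
  from sums_Suc[OF this] show ?thesis
    unfolding state_value_eq[of s] by (simp add: sums_iff add.commute)
qed

end

section \<open>The value gap\<close>

text \<open>An average cannot strictly exceed every value averaged. This replaces a randomized
  choice by a single action.\<close>

lemma (in mdp_policy) exists_action_ge_expect_next:
  "\<exists>a\<in>actions M. expect_next M \<pi> w s \<le> (\<Sum>s'\<in>UNIV. pmf (transition M s a) s' * w s')"
proof (rule ccontr)
  let ?f = "\<lambda>a. \<Sum>s'\<in>UNIV. pmf (transition M s a) s' * w s'"
  interpret prob_space "\<pi> s" by (rule prob_space_policy)
  assume "\<not> (\<exists>a\<in>actions M. expect_next M \<pi> w s \<le> ?f a)"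
  then have "AE a in \<pi> s. ?f a < expect_next M \<pi> w s"
    by (intro AE_I2) (auto simp: space_policy not_le)
  moreover have "integrable (\<pi> s) ?f" by (simp add: integrable_transition)
  ultimately have "expectation ?f < expect_next M \<pi> w s" by (intro expectation_less)
  then show False by (simp add: expect_next_eq_integral)
qed

text \<open>The largest difference \<open>m\<close> over the states satisfies
  \<open>m \<le> discount M * (c + m)\<close>, where \<open>c\<close> is the loss in one step;
  solving for \<open>m\<close> gives the bound.\<close>

lemma state_value_diff_le:
  assumes "mdp_policy M \<mu>" "mdp_policy M' \<pi>"
    and same: "discount M' = discount M" "reward M' = reward M"
    and c: "\<And>s. expect_next M \<mu> (state_value M \<mu>) s \<le> expect_next M' \<pi> (state_value M \<mu>) s + c"
  shows "state_value M \<mu> s - state_value M' \<pi> s \<le> discount M * c / (1 - discount M)"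
proof -
  interpret \<mu>: mdp_policy M \<mu> by fact
  interpret \<pi>: mdp_policy M' \<pi> by fact
  define d where "d s = state_value M \<mu> s - state_value M' \<pi> s" for s
  define m where "m = Max (range d)"
  have m: "d s \<le> m" for s unfolding m_def by (intro Max_ge) auto
  have "d s \<le> discount M * (c + m)" for s
  proof -
    \<comment> \<open>The mean rewards cancel because they depend on the state alone, not on the
      action.\<close>
    have "d s = discount M * (expect_next M \<mu> (state_value M \<mu>) s
        - expect_next M' \<pi> (state_value M' \<pi>) s)"
      unfolding d_def \<mu>.state_value_bellman[of s] \<pi>.state_value_bellman[of s]
      by (simp add: same mean_reward_def algebra_simps)
    also have "\<dots> \<le> discount M * (c + expect_next M' \<pi> d s)"
      using c[of s] \<mu>.discount_nonneg unfolding d_def \<pi>.expect_next_diff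
      by (intro mult_left_mono) auto
    also have "\<dots> \<le> discount M * (c + m)"
      using \<pi>.expect_next_le[OF m] \<mu>.discount_nonneg by (intro mult_left_mono add_left_mono) auto
    finally show ?thesis .
  qed
  moreover have "m \<in> range d" unfolding m_def by (intro Max_in) auto
  ultimately have "m \<le> discount M * (c + m)" by auto
  then have "m \<le> discount M * c / (1 - discount M)"
    using \<mu>.discount_less_1 by (simp add: field_simps)
  with m[of s] show ?thesis by (simp add: d_def)
qed

text \<open>Hoelder's inequality for the 1-norm and the maximum norm, applied to
  \<open>p - q\<close> and \<open>w\<close>.\<close>

lemma sum_mult_le_l1_distance:
  fixes p q w :: "'b \<Rightarrow> real"
  assumes "\<And>x. x \<in> X \<Longrightarrow> \<bar>w x\<bar> \<le> B"
  shows "(\<Sum>x\<in>X. p x * w x) \<le> (\<Sum>x\<in>X. q x * w x) + (\<Sum>x\<in>X. \<bar>p x - q x\<bar>) * B"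
proof -
  have "p x * w x \<le> q x * w x + \<bar>p x - q x\<bar> * B" if "x \<in> X" for x
  proof -
    have "(p x - q x) * w x \<le> \<bar>p x - q x\<bar> * \<bar>w x\<bar>" by (simp flip: abs_mult)
    also have "\<dots> \<le> \<bar>p x - q x\<bar> * B" using assms[OF that] by (intro mult_left_mono) auto
    finally show ?thesis by (simp add: algebra_simps)
  qed
  then show ?thesis by (simp add: sum_mono sum_distrib_right flip: sum.distrib)
qed

section \<open>Runs of the L-MDP and the structure gap\<close>

lemma lmdp_run_same:
  assumes "lmdp_run L \<tau> k M"
  shows "transition M = transition (base L)" "reward M = reward (base L)"
    "rmax M = rmax (base L)" "discount M = discount (base L)"
  using assms by induction auto

lemma is_mdp_cong:
  assumes "reward M' = reward M" "rmax M' = rmax M" "discount M' = discount M"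
  shows "is_mdp M' \<longleftrightarrow> is_mdp M"
  unfolding is_mdp_def assms by (rule refl)

lemma full_mdp_simps [simp]:
  "actions (full_mdp L) = obs L ` structures L"
  "transition (full_mdp L) = transition (base L)"
  "reward (full_mdp L) = reward (base L)"
  "rmax (full_mdp L) = rmax (base L)"
  "discount (full_mdp L) = discount (base L)"
  by (simp_all add: full_mdp_def)

lemma l1_norm_nonneg: "0 \<le> l1_norm x"
  by (simp add: l1_norm_def sum_nonneg)

text \<open>A structure must exist, since the supremum over the empty set is minus infinity in
  \<open>ereal\<close>.\<close>

lemma structure_gap_nonneg:
  assumes "structures L \<noteq> {}"
  shows "0 \<le> structure_gap L M"
proof -
  obtain e where "e \<in> structures L" using assms by auto
  then show ?thesis
    unfolding structure_gap_def
    by (intro SUP_upper2 INF_greatest) (auto simp: l1_norm_nonneg)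
qed

text \<open>The infimum in the gap need not be attained; a strict upper bound \<open>\<eta>\<close>
  still yields an available structure, and in particular an available action.\<close>

lemma structure_gap_lessE:
  assumes "structure_gap L M < ereal \<eta>" "e \<in> structures L"
  obtains e' where "e' \<in> structures L" "obs L e' \<in> actions M" "l1_norm (e - e') < \<eta>"
proof -
  have "(INF e'\<in>{e \<in> structures L. obs L e \<in> actions M}. ereal (l1_norm (e - e'))) < ereal \<eta>"
    using assms unfolding structure_gap_def by (meson SUP_upper le_less_trans)
  then show ?thesis using that by (auto simp: INF_less_iff)
qed

section \<open>Policies obtained through the inverse dynamics\<close>

lemma overall_policies_subset_policies:
  assumes "h \<in> E \<rightarrow>\<^sub>M prob_algebra (count_space (actions M))"
  shows "overall_policies E h \<subseteq> policies M"
  using bind_in_prob_algebra[OF _ assms] by (auto simp: overall_policies_def policies_def)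

lemma inferred_action_eq_bind:
  assumes \<psi>: "\<And>s s'. \<psi> s s' \<in> space (prob_algebra E)"
    and h: "h \<in> E \<rightarrow>\<^sub>M prob_algebra N"
  shows "inferred_action M \<psi> h s a = (measure_pmf (transition M s a) \<bind> \<psi> s) \<bind> h"
  unfolding inferred_action_def
  using \<psi> by (intro bind_assoc[symmetric, OF _ measurable_prob_algebraD[OF h]]
      measurable_prob_algebraD) simp

lemma measure_pmf_in_prob_algebra: "measure_pmf p \<in> space (prob_algebra (count_space UNIV))"
  by (simp add: space_prob_algebra measure_pmf.prob_space_axioms)

text \<open>By associativity of bind, averaging the inverse dynamics over the next state gives a
  state-conditional component, and the kernel \<open>h\<close> comes last. So choosing an action in
  each state and passing it through both maps is a representable policy.\<close>

lemma inferred_action_policy: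
  assumes \<psi>: "\<And>s s'. \<psi> s s' \<in> space (prob_algebra E)"
    and h: "h \<in> E \<rightarrow>\<^sub>M prob_algebra N"
  shows "(\<lambda>s. inferred_action M \<psi> h s (f s)) \<in> overall_policies E h"
proof -
  have "measure_pmf (transition M s (f s)) \<bind> \<psi> s \<in> space (prob_algebra E)" for s
    using \<psi> by (intro bind_in_prob_algebra[OF measure_pmf_in_prob_algebra]) simp
  then show ?thesis
    unfolding overall_policies_def
    by (auto simp: inferred_action_eq_bind[OF \<psi> h]
        intro!: exI[of _ "\<lambda>s. measure_pmf (transition M s (f s)) \<bind> \<psi> s"])
qed

text \<open>The second claim identifies the measure in the KL condition with the
  \<open>policy_transition\<close> of the policy built by \<open>inferred_action\<close>.\<close>

lemma
  fixes M :: "('s::finite, 'a) mdp"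
  assumes \<psi>: "\<And>s s'. \<psi> s s' \<in> space (prob_algebra E)"
    and h: "h \<in> E \<rightarrow>\<^sub>M prob_algebra (count_space (actions M))"
  shows inferred_transition_in_prob_algebra:
      "inferred_transition M \<psi> h s a \<in> space (prob_algebra (count_space UNIV))"
    and measure_inferred_transition:
      "measure (inferred_transition M \<psi> h s a) {s'}
        = (\<integral>a'. pmf (transition M s a') s' \<partial>inferred_action M \<psi> h s a)"
proof -
  let ?A = "inferred_action M \<psi> h s a"
  have A: "?A \<in> space (prob_algebra (count_space (actions M)))"
  proof -
    have "(\<lambda>s. inferred_action M \<psi> h s a) \<in> overall_policies E h"
      by (rule inferred_action_policy[OF \<psi> h])
    then show ?thesis
      using overall_policies_subset_policies[OF h] by (auto simp: policies_def)
  qed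
  have P: "(\<lambda>a'. measure_pmf (transition M s a'))
      \<in> count_space (actions M) \<rightarrow>\<^sub>M prob_algebra (count_space UNIV)"
    using measure_pmf_in_prob_algebra by auto
  show "inferred_transition M \<psi> h s a \<in> space (prob_algebra (count_space UNIV))"
    unfolding inferred_transition_def by (rule bind_in_prob_algebra[OF A P])
  have sets: "sets ?A = sets (count_space (actions M))" and ps: "prob_space ?A"
    using A by (auto simp: space_prob_algebra)
  interpret prob_space ?A by (rule ps)
  have "(\<lambda>a'. measure_pmf (transition M s a')) \<in> ?A \<rightarrow>\<^sub>M subprob_algebra (count_space UNIV)"
    using measurable_prob_algebraD[OF P] by (simp add: measurable_cong_sets[OF sets refl])
  then show "measure (inferred_transition M \<psi> h s a) {s'}
      = (\<integral>a'. pmf (transition M s a') s' \<partial>?A)"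
    unfolding inferred_transition_def by (subst measure_bind) (auto simp: measure_pmf_single)
qed

theorem theorem2:
  fixes L :: "('s::finite, 'a, 'd::finite) lmdp"
    and M\<^sub>k :: "('s, 'a) mdp"
    and \<rho> \<delta>\<^sub>k :: real
    and \<tau> k :: nat
    and E' :: "(real ^ 'd) measure"
    and \<psi> :: "'s \<Rightarrow> 's \<Rightarrow> (real ^ 'd) measure"
    and h\<^sub>k :: "real ^ 'd \<Rightarrow> 'a measure"
    and \<mu> \<pi>\<^sub>k :: "'s \<Rightarrow> 'a measure"
    and s\<^sub>0 :: 's
  assumes "is_lmdp L"
    and "lipschitz_structure L \<rho>"
    and "lmdp_run L \<tau> k M\<^sub>k"
    and "0 \<le> \<delta>\<^sub>k"
    and "\<forall>s s'. \<psi> s s' \<in> space (prob_algebra E')"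
    and "h\<^sub>k \<in> E' \<rightarrow>\<^sub>M prob_algebra (count_space (actions M\<^sub>k))"
    and "(SUP s. SUP a\<in>actions M\<^sub>k.
            kl (measure_pmf (transition M\<^sub>k s a)) (inferred_transition M\<^sub>k \<psi> h\<^sub>k s a))
          \<le> ereal (\<delta>\<^sub>k\<^sup>2 / 2)"
    and "best_policy (full_mdp L) (policies (full_mdp L)) \<mu>"
    and "best_policy M\<^sub>k (overall_policies E' h\<^sub>k) \<pi>\<^sub>k"
    and "s\<^sub>0 \<in> set_pmf (init (base L))"
  shows "ereal (state_value (full_mdp L) \<mu> s\<^sub>0 - state_value M\<^sub>k \<pi>\<^sub>k s\<^sub>0)
    \<le> ereal (discount (base L)) * (ereal \<rho> * structure_gap L M\<^sub>k + ereal \<delta>\<^sub>k)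
        / ereal ((1 - discount (base L))\<^sup>2) * ereal (rmax (base L))"
proof -
  note run = lmdp_run_same[OF assms(3)]
  have \<psi>: "\<psi> s s' \<in> space (prob_algebra E')" for s s' using assms(5) by blast
  note h = assms(6)
  define \<gamma> where "\<gamma> = discount (base L)"
  define R where "R = rmax (base L)"
  have base: "is_mdp (base L)" using assms(1) by (simp add: is_lmdp_def)
  have mdp_k: "is_mdp M\<^sub>k" and mdp_full: "is_mdp (full_mdp L)"
    using base is_mdp_cong[of M\<^sub>k "base L"] is_mdp_cong[of "full_mdp L" "base L"] run by simp_all
  have policy_k: "mdp_policy M\<^sub>k \<pi>" if "\<pi> \<in> overall_policies E' h\<^sub>k" for \<pi>
    using that overall_policies_subset_policies[OF h] mdp_k by (auto simp: mdp_policy_def)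
  have \<pi>\<^sub>k: "\<pi>\<^sub>k \<in> overall_policies E' h\<^sub>k"
    and best: "\<And>\<pi> s. \<pi> \<in> overall_policies E' h\<^sub>k \<Longrightarrow> state_value M\<^sub>k \<pi> s \<le> state_value M\<^sub>k \<pi>\<^sub>k s"
    using assms(9) by (auto simp: best_policy_def)
  interpret \<mu>: mdp_policy "full_mdp L" \<mu>
    using assms(8) mdp_full by (simp add: mdp_policy_def best_policy_def)
  interpret k: mdp_policy M\<^sub>k \<pi>\<^sub>k by (rule policy_k[OF \<pi>\<^sub>k])
  have \<gamma>: "0 \<le> \<gamma>" "\<gamma> < 1" using base by (auto simp: is_mdp_def \<gamma>_def)
  have R: "0 \<le> R" using \<mu>.rmax_nonneg by (simp add: R_def)
  have \<rho>: "0 < \<rho>" using assms(2) by (simp add: lipschitz_structure_def)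
  define v where "v = state_value (full_mdp L) \<mu>"
  have v: "\<bar>v s\<bar> \<le> R / (1 - \<gamma>)" for s
    using \<mu>.abs_state_value_le[of s] by (simp add: v_def R_def \<gamma>_def)
  \<comment> \<open>Pinsker's factor 2 cancels the 2 in the KL bound; the square root is taken using
    \<open>0 \<le> \<delta>\<^sub>k\<close>.\<close>
  have pinsker_k: "(\<Sum>s'\<in>UNIV. \<bar>pmf (transition M\<^sub>k s a) s'
      - measure (inferred_transition M\<^sub>k \<psi> h\<^sub>k s a) {s'}\<bar>) \<le> \<delta>\<^sub>k"
    if "a \<in> actions M\<^sub>k" for s a
  proof (rule power2_le_imp_le[OF _ assms(4)])
    have "kl (measure_pmf (transition M\<^sub>k s a)) (inferred_transition M\<^sub>k \<psi> h\<^sub>k s a)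
        \<le> (SUP s. SUP a\<in>actions M\<^sub>k.
            kl (measure_pmf (transition M\<^sub>k s a)) (inferred_transition M\<^sub>k \<psi> h\<^sub>k s a))"
      using that by (intro SUP_upper2[of s] SUP_upper2[of a]) auto
    with assms(7) have "kl (measure_pmf (transition M\<^sub>k s a)) (inferred_transition M\<^sub>k \<psi> h\<^sub>k s a)
        \<le> ereal (\<delta>\<^sub>k\<^sup>2 / 2)" by (rule order_trans[rotated])
    from pinsker[OF inferred_transition_in_prob_algebra[OF \<psi> h] this]
    show "(\<Sum>s'\<in>UNIV. \<bar>pmf (transition M\<^sub>k s a) s'
      - measure (inferred_transition M\<^sub>k \<psi> h\<^sub>k s a) {s'}\<bar>)\<^sup>2 \<le> \<delta>\<^sub>k\<^sup>2" by simp
  qed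
  have bound: "v s\<^sub>0 - state_value M\<^sub>k \<pi>\<^sub>k s\<^sub>0 \<le> \<gamma> * (\<rho> * \<eta> + \<delta>\<^sub>k) / (1 - \<gamma>)\<^sup>2 * R"
    if \<eta>: "structure_gap L M\<^sub>k < ereal \<eta>" for \<eta>
  proof -
    \<comment> \<open>First a possible action at least as good as \<open>\<mu>\<close> in one step,
      then an available one with a nearby structure; the Lipschitz loss is scaled by the bound on
      \<open>v\<close>.\<close>
    have "\<exists>a\<in>actions M\<^sub>k. expect_next (full_mdp L) \<mu> v s
        \<le> (\<Sum>s'\<in>UNIV. pmf (transition M\<^sub>k s a) s' * v s') + \<rho> * \<eta> * (R / (1 - \<gamma>))" for s
    proof -
      obtain e where e: "e \<in> structures L" and
        le: "expect_next (full_mdp L) \<mu> v s \<le> (\<Sum>s'\<in>UNIV. pmf (struct_transition L s e) s' * v s')"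
        using \<mu>.exists_action_ge_expect_next[of v s] by (auto simp: struct_transition_def)
      obtain e' where e': "e' \<in> structures L" "obs L e' \<in> actions M\<^sub>k" "l1_norm (e - e') < \<eta>"
        using structure_gap_lessE[OF \<eta> e] .
      have "(\<Sum>s'\<in>UNIV. \<bar>pmf (struct_transition L s e) s' - pmf (struct_transition L s e') s'\<bar>)
          \<le> \<rho> * l1_norm (e - e')"
        using assms(2) e e'(1) by (simp add: lipschitz_structure_def)
      also have "\<dots> \<le> \<rho> * \<eta>" using e'(3) \<rho> by simp
      finally have "(\<Sum>s'\<in>UNIV. \<bar>pmf (struct_transition L s e) s' - pmf (struct_transition L s e') s'\<bar>)
          * (R / (1 - \<gamma>)) \<le> \<rho> * \<eta> * (R / (1 - \<gamma>))"
        using R \<gamma> by (intro mult_right_mono) auto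
      with le sum_mult_le_l1_distance[of UNIV v, OF v,
          of "pmf (struct_transition L s e)" "pmf (struct_transition L s e')"]
      have "expect_next (full_mdp L) \<mu> v s
          \<le> (\<Sum>s'\<in>UNIV. pmf (struct_transition L s e') s' * v s') + \<rho> * \<eta> * (R / (1 - \<gamma>))"
        by linarith
      then show ?thesis using e'(2) by (auto simp: struct_transition_def run)
    qed
    then obtain f where f: "\<And>s. f s \<in> actions M\<^sub>k"
      and fv: "\<And>s. expect_next (full_mdp L) \<mu> v s
        \<le> (\<Sum>s'\<in>UNIV. pmf (transition M\<^sub>k s (f s)) s' * v s') + \<rho> * \<eta> * (R / (1 - \<gamma>))"
      by metis
    \<comment> \<open>The comparison policy: representable with the fixed \<open>h\<^sub>k\<close>,
      and within \<open>\<delta>\<^sub>k\<close> of the transitions of \<open>f\<close>.\<close>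
    define \<pi> where "\<pi> s = inferred_action M\<^sub>k \<psi> h\<^sub>k s (f s)" for s
    have \<pi>: "\<pi> \<in> overall_policies E' h\<^sub>k"
      unfolding \<pi>_def[abs_def] by (rule inferred_action_policy[OF \<psi> h])
    have close: "expect_next (full_mdp L) \<mu> v s
        \<le> expect_next M\<^sub>k \<pi> v s + (\<rho> * \<eta> + \<delta>\<^sub>k) * (R / (1 - \<gamma>))" for s
    proof -
      have "(\<Sum>s'\<in>UNIV. \<bar>pmf (transition M\<^sub>k s (f s)) s' - policy_transition M\<^sub>k \<pi> s s'\<bar>)
          * (R / (1 - \<gamma>)) \<le> \<delta>\<^sub>k * (R / (1 - \<gamma>))"
        using pinsker_k[OF f, of s s] R \<gamma>
        by (intro mult_right_mono)
           (auto simp: measure_inferred_transition[OF \<psi> h] policy_transition_def \<pi>_def)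
      with fv[of s] sum_mult_le_l1_distance[of UNIV v, OF v,
          of "pmf (transition M\<^sub>k s (f s))" "policy_transition M\<^sub>k \<pi> s"]
      show ?thesis unfolding expect_next_def[of M\<^sub>k] by (simp only: distrib_right)
    qed
    \<comment> \<open>One factor \<open>1 / (1 - \<gamma>)\<close> comes from the bound on
      \<open>v\<close>, the other from summing the one-step losses over time.\<close>
    have "v s\<^sub>0 - state_value M\<^sub>k \<pi> s\<^sub>0
        \<le> \<gamma> * ((\<rho> * \<eta> + \<delta>\<^sub>k) * (R / (1 - \<gamma>))) / (1 - \<gamma>)"
      using state_value_diff_le[OF \<mu>.mdp_policy_axioms policy_k[OF \<pi>] _ _ close[unfolded v_def], of s\<^sub>0] run
      by (simp add: v_def \<gamma>_def)
    also have "\<dots> = \<gamma> * (\<rho> * \<eta> + \<delta>\<^sub>k) / (1 - \<gamma>)\<^sup>2 * R"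
      by (simp add: power2_eq_square)
    finally show ?thesis using best[OF \<pi>, of s\<^sub>0] by linarith
  qed
  \<comment> \<open>The law \<open>\<mu> s\<close> is a probability measure on the possible actions,
    so these cannot be empty.\<close>
  have "structures L \<noteq> {}"
    using prob_space.not_empty[OF \<mu>.prob_space_policy] \<mu>.space_policy by auto
  then have gap: "0 \<le> structure_gap L M\<^sub>k" by (rule structure_gap_nonneg)
  have "ereal (v s\<^sub>0 - state_value M\<^sub>k \<pi>\<^sub>k s\<^sub>0)
    \<le> ereal \<gamma> * (ereal \<rho> * structure_gap L M\<^sub>k + ereal \<delta>\<^sub>k) / ereal ((1 - \<gamma>)\<^sup>2) * ereal R"
  proof (cases "structure_gap L M\<^sub>k")
    case (real g)
    have "v s\<^sub>0 - state_value M\<^sub>k \<pi>\<^sub>k s\<^sub>0 \<le> \<gamma> * (\<rho> * g + \<delta>\<^sub>k) / (1 - \<gamma>)\<^sup>2 * R"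
    \<comment> \<open>The bound is available only for \<open>\<eta>\<close> strictly above the gap
      and is continuous in \<open>\<eta>\<close>, so the limit is taken from the right.\<close>
    proof (rule tendsto_lowerbound[where F="at_right g"])
      show "((\<lambda>\<eta>. \<gamma> * (\<rho> * \<eta> + \<delta>\<^sub>k) / (1 - \<gamma>)\<^sup>2 * R)
          \<longlongrightarrow> \<gamma> * (\<rho> * g + \<delta>\<^sub>k) / (1 - \<gamma>)\<^sup>2 * R) (at_right g)"
        using \<gamma> by (intro tendsto_intros) auto
      show "\<forall>\<^sub>F \<eta> in at_right g. v s\<^sub>0 - state_value M\<^sub>k \<pi>\<^sub>k s\<^sub>0
          \<le> \<gamma> * (\<rho> * \<eta> + \<delta>\<^sub>k) / (1 - \<gamma>)\<^sup>2 * R"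
        using eventually_at_right_less[of g] by eventually_elim (rule bound, simp add: real)
    qed simp
    then show ?thesis using \<gamma> by (simp add: real)
  next
    case PInf
    show ?thesis
    proof (cases "\<gamma> = 0 \<or> R = 0")
      \<comment> \<open>Here the right-hand side is 0, as zero times infinity is 0 in
        \<open>ereal\<close>. The values agree: for \<open>R = 0\<close> both vanish, and for
        \<open>\<gamma> = 0\<close> both equal the mean reward of the initial state.\<close>
      case True
      have "v s\<^sub>0 - state_value M\<^sub>k \<pi>\<^sub>k s\<^sub>0 = 0"
      proof (cases "R = 0")
        case True
        then show ?thesis using v[of s\<^sub>0] k.abs_state_value_le[of s\<^sub>0] by (simp add: run R_def)
      next
        case False
        with True have "\<gamma> = 0" by simp
        then show ?thesis
          using \<mu>.state_value_bellman[of s\<^sub>0] k.state_value_bellman[of s\<^sub>0]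
          by (simp add: v_def \<gamma>_def run mean_reward_def)
      qed
      then show ?thesis using True by (auto simp flip: zero_ereal_def)
    next
      case False
      then show ?thesis using PInf \<gamma> R \<rho> by (simp add: ereal_divide)
    qed
  qed (use gap in simp)
  then show ?thesis by (simp only: v_def \<gamma>_def R_def)
qed

end
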